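(* For every integer $n\ge 1$, $$MD_n \sim HMD_{n-1}\ \dot{\cup}\ HMD_{n-1}\ \dot{\cup}\ R_n\ \dot{\cup}\ R'_n.$$
   Context: The adjacency matrix of a weighted graph has rows and columns indexed by the vertices, its $(u,v)$-entry being the weight of the edge between $u$ and $v$ if there is one, and $0$ otherwise (a loop of weight $c$ at $u$ contributes the diagonal entry $c$); unweighted graphs have all weights $1$. Two graphs are called similar, written $G_1\sim G_2$, if their adjacency matrices are similar matrices. $\dot\cup$ denotes disjoint union. The mixed Aztec diamond $MD_n$ is the graph whose vertices are the black unit squares of a $2n\times 2n$ chessboard, two vertices being adjacent if the corresponding squares share a corner. The halved mixed Aztec diamond $HMD_n$ is the subgraph of $MD_n$ induced by the black squares on or above the black diagonal of the $2n\times 2n$ board (the main diagonal consisting of black squares); $HMD_0$ is the empty graph. $P_n$ is the path on $n$ vertices (edge weights $1$). $Q_n$ is the graph obtained from $P_n$ by including a loop of weight $2$ at each vertex, and $Q'_n$ is obtained from $P_n$ by including a loop of weight $-2$ at each vertex. $R_n$ is obtained from $Q_n$ by changing the weight of the loop at the last vertex of the path to $1$, and $R'_n$ is obtained from $Q'_n$ by changing the weight of the loop at the last vertex to $-1$. *)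

theory Defs
  imports Complex_Main "Jordan_Normal_Form.Matrix"
begin

text \<open>
  Weighted undirected graphs with loops. An edge is the set of its end points, so a loop at
  \<open>u\<close> is the edge \<open>{u}\<close>. The value of \<open>weight\<close> is only meaningful on members of \<open>edges\<close>.
\<close>

record 'v wgraph =
  verts :: "'v set"
  edges :: "'v set set"
  weight :: "'v set \<Rightarrow> real"

definition adjacency :: "'v wgraph \<Rightarrow> 'v \<Rightarrow> 'v \<Rightarrow> real" where
  "adjacency G u v = (if {u, v} \<in> edges G then weight G {u, v} else 0)"

text \<open>The list \<open>vs\<close> says which vertex belongs to which row and column.\<close>

definition adjacency_mat :: "'v wgraph \<Rightarrow> 'v list \<Rightarrow> real mat" where
  "adjacency_mat G vs =
     mat (length vs) (length vs) (\<lambda>(i, j). adjacency G (vs ! i) (vs ! j))"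

definition enumerates :: "'v list \<Rightarrow> 'v wgraph \<Rightarrow> bool" where
  "enumerates vs G \<longleftrightarrow> distinct vs \<and> set vs = verts G"

text \<open>
  Reordering the vertices conjugates the adjacency matrix by a permutation matrix, so it does not
  matter which enumerations are chosen. They exist exactly for finite graphs.
\<close>

definition similar_graph :: "'a wgraph \<Rightarrow> 'b wgraph \<Rightarrow> bool"  (infix \<open>\<sim>\<^sub>G\<close> 50) where
  "G \<sim>\<^sub>G H \<longleftrightarrow>
     (\<exists>vs ws. enumerates vs G \<and> enumerates ws H \<and>
        similar_mat (adjacency_mat G vs) (adjacency_mat H ws))"

definition disjoint_union :: "'a wgraph \<Rightarrow> 'b wgraph \<Rightarrow> ('a + 'b) wgraph"
    (infixr \<open>\<union>\<^sub>G\<close> 65) where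
  "G \<union>\<^sub>G H =
     \<lparr>verts = verts G <+> verts H,
      edges = (\<lambda>e. Inl ` e) ` edges G \<union> (\<lambda>e. Inr ` e) ` edges H,
      weight = (\<lambda>e. if e \<subseteq> range Inl then weight G (Inl -` e) else weight H (Inr -` e))\<rparr>"

definition induced_subgraph :: "'v wgraph \<Rightarrow> 'v set \<Rightarrow> 'v wgraph" where
  "induced_subgraph G S = G\<lparr>verts := verts G \<inter> S, edges := {e \<in> edges G. e \<subseteq> S}\<rparr>"

text \<open>
  The unit square \<open>(i, j)\<close> lies in row \<open>i\<close>, counted from the top, and column \<open>j\<close>, both from \<open>0\<close>.
  The squares with \<open>i = j\<close>, the main diagonal, are black, and a square lies on or above that
  diagonal iff \<open>i \<le> j\<close>.
\<close>

type_synonym square = "nat \<times> nat"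

definition black_squares :: "nat \<Rightarrow> square set" where
  "black_squares m = {(i, j). i < m \<and> j < m \<and> even (i + j)}"

fun corners :: "square \<Rightarrow> (nat \<times> nat) set" where
  "corners (i, j) = {(i, j), (i, Suc j), (Suc i, j), (Suc i, Suc j)}"

definition MD :: "nat \<Rightarrow> square wgraph" where
  "MD n =
     \<lparr>verts = black_squares (2 * n),
      edges = {{s, t} | s t. s \<in> black_squares (2 * n) \<and> t \<in> black_squares (2 * n) \<and>
                 s \<noteq> t \<and> corners s \<inter> corners t \<noteq> {}},
      weight = (\<lambda>_. 1)\<rparr>"

definition HMD :: "nat \<Rightarrow> square wgraph" where
  "HMD n = induced_subgraph (MD n) {(i, j). i \<le> j}"

definition path_graph :: "nat \<Rightarrow> nat wgraph" where
  "path_graph n =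
     \<lparr>verts = {..<n}, edges = {{k, Suc k} | k. Suc k < n}, weight = (\<lambda>_. 1)\<rparr>"

text \<open>A loop of weight \<open>c\<close> at every vertex, replacing any loop already there.\<close>

definition add_loops :: "real \<Rightarrow> 'v wgraph \<Rightarrow> 'v wgraph" where
  "add_loops c G =
     G\<lparr>edges := edges G \<union> {{u} | u. u \<in> verts G},
       weight := (\<lambda>e. if \<exists>u \<in> verts G. e = {u} then c else weight G e)\<rparr>"

definition set_weight :: "'v set \<Rightarrow> real \<Rightarrow> 'v wgraph \<Rightarrow> 'v wgraph" where
  "set_weight e c G = G\<lparr>weight := (weight G)(e := c)\<rparr>"

definition Q_graph :: "nat \<Rightarrow> nat wgraph" where
  "Q_graph n = add_loops 2 (path_graph n)"

definition Q'_graph :: "nat \<Rightarrow> nat wgraph" where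
  "Q'_graph n = add_loops (- 2) (path_graph n)"

text \<open>The last vertex of the path is \<open>n - 1\<close>; the following two are used for \<open>n \<ge> 1\<close> only.\<close>

definition R_graph :: "nat \<Rightarrow> nat wgraph" where
  "R_graph n = set_weight {n - 1} 1 (Q_graph n)"

definition R'_graph :: "nat \<Rightarrow> nat wgraph" where
  "R'_graph n = set_weight {n - 1} (- 1) (Q'_graph n)"

end

theory Submission
  imports Defs "Jordan_Normal_Form.Determinant"
begin

text \<open>
  Functions on the squares of the board are \<open>2n \<times> 2n\<close> matrices, and the adjacency operator of \<open>MD n\<close>
  is \<open>M \<mapsto> A M A\<close> on the matrices supported on black squares, \<open>A\<close> being the adjacency matrix of the
  path on \<open>2n\<close> vertices. Antisymmetric matrices form an invariant subspace, and restriction to the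
  squares strictly above the diagonal turns the operator on it into that of \<open>HMD (n - 1)\<close>. The map
  \<open>M \<mapsto> [A\<^sup>2, M]\<close> commutes with the operator and carries antisymmetric matrices to symmetric ones,
  which gives the second copy. Another invariant subspace consists of the even polynomials in \<open>A\<close>, on
  which the operator is multiplication by \<open>A\<^sup>2\<close>; in the basis of Chebyshev polynomials this is the
  graph \<open>R_graph n\<close>. Multiplying these matrices by \<open>S = diag((-1)\<^sup>i)\<close>, which anticommutes with \<open>A\<close>,
  gives \<open>R'_graph n\<close>.

  The four pieces have the right total dimension, so it remains to see that they are independent.
  Transposition splits off the first one. If \<open>[A\<^sup>2, M] = F + S F'\<close> with \<open>F\<close>, \<open>F'\<close> even
  polynomials in \<open>A\<close>, then \<open>[A\<^sup>2, [A\<^sup>2, M]] = 0\<close>, whence \<open>[A\<^sup>2, M] = 0\<close> because \<open>[A\<^sup>2, \<cdot>]\<close> is self-adjoint for the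
  Frobenius inner product, and this forces \<open>M = 0\<close>. Finally, \<open>F + S F' = 0\<close> forces \<open>F = F' = 0\<close> by
  inspection of the first two rows.
\<close>

subsection \<open>Similarity from intertwining maps\<close>

text \<open>Entrywise form of \<open>X T = T Y\<close> for the adjacency matrices \<open>X\<close>
  of \<open>G\<close> and \<open>Y\<close> of \<open>H\<close>; if the columns of \<open>T\<close>
  are independent, \<open>X\<close> acts on their span as \<open>Y\<close>.\<close>

definition intertwines :: "'a wgraph \<Rightarrow> 'b wgraph \<Rightarrow> ('a \<Rightarrow> 'b \<Rightarrow> real) \<Rightarrow> bool" where
  "intertwines G H T \<longleftrightarrow> (\<forall>u \<in> verts G. \<forall>w \<in> verts H.
     (\<Sum>v\<in>verts G. adjacency G u v * T v w) = (\<Sum>x\<in>verts H. T u x * adjacency H x w))"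

lemma sum_enumerates:
  assumes "enumerates vs G"
  shows "(\<Sum>v\<in>verts G. f v) = (\<Sum>i<length vs. f (vs ! i))"
  using sum.reindex_bij_betw[OF bij_betw_nth[of vs "{..<length vs}" "verts G"], of f] assms
  by (simp add: enumerates_def)

text \<open>A square intertwining matrix with trivial kernel is invertible and conjugates one
  adjacency matrix into the other.\<close>

lemma similar_graph_if_intertwines:
  assumes fin: "finite (verts G)" "finite (verts H)"
    and card: "card (verts G) = card (verts H)"
    and T: "intertwines G H T"
    and inj: "\<And>c. \<lbrakk>\<And>u. u \<in> verts G \<Longrightarrow> (\<Sum>w\<in>verts H. T u w * c w) = 0\<rbrakk>
                \<Longrightarrow> \<forall>w \<in> verts H. c w = 0"
  shows "G \<sim>\<^sub>G H"
proof -
  obtain vs ws where vs: "enumerates vs G" and ws: "enumerates ws H"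
    using fin by (metis enumerates_def finite_distinct_list)
  define N where "N = length vs"
  have lenw: "length ws = N"
    using vs ws card by (metis N_def enumerates_def distinct_card)
  have vsin: "vs ! i \<in> verts G" and wsin: "ws ! i \<in> verts H" if "i < N" for i
    using that vs ws lenw by (auto simp: N_def enumerates_def dest: nth_mem)
  define A where "A = adjacency_mat G vs"
  define B where "B = adjacency_mat H ws"
  define P where "P = mat N N (\<lambda>(i, j). T (vs ! i) (ws ! j))"
  have carr: "A \<in> carrier_mat N N" "B \<in> carrier_mat N N" "P \<in> carrier_mat N N"
    by (auto simp: A_def B_def P_def adjacency_mat_def N_def lenw)
  have AP: "A * P = P * B"
  proof (rule eq_matI)
    fix i j assume "i < dim_row (P * B)" "j < dim_col (P * B)"
    then have i: "i < N" and j: "j < N" using carr by auto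
    have "(A * P) $$ (i, j) = (\<Sum>k<N. adjacency G (vs ! i) (vs ! k) * T (vs ! k) (ws ! j))"
      using i j carr by (simp add: A_def P_def adjacency_mat_def N_def[symmetric]
          scalar_prod_def atLeast0LessThan)
    also have "\<dots> = (\<Sum>k<N. T (vs ! i) (ws ! k) * adjacency H (ws ! k) (ws ! j))"
      using T vsin[OF i] wsin[OF j]
      by (simp add: intertwines_def sum_enumerates[OF vs] sum_enumerates[OF ws] lenw
          flip: N_def)
    also have "\<dots> = (P * B) $$ (i, j)"
      using i j carr by (simp add: B_def P_def adjacency_mat_def lenw
          scalar_prod_def atLeast0LessThan)
    finally show "(A * P) $$ (i, j) = (P * B) $$ (i, j)" .
  qed (use carr in auto)
  have "det P \<noteq> 0"
  proof
    assume "det P = 0"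
    then obtain v where v: "v \<in> carrier_vec N" "v \<noteq> 0\<^sub>v N" "P *\<^sub>v v = 0\<^sub>v N"
      using det_0_iff_vec_prod_zero_field[OF carr(3)] by auto
    \<comment> \<open>The kernel vector is reread as a function on the vertices of \<open>H\<close>,
      the form that \<open>inj\<close> speaks about.\<close>
    define c where "c w = v $ (inv_into {..<N} ((!) ws) w)" for w
    have "inj_on ((!) ws) {..<N}"
      using ws lenw by (simp add: enumerates_def inj_on_nth)
    then have c: "c (ws ! k) = v $ k" if "k < N" for k
      using that by (simp add: c_def)
    have "\<forall>w \<in> verts H. c w = 0"
    proof (rule inj)
      fix u assume "u \<in> verts G"
      then obtain i where i: "i < N" "u = vs ! i"
        using vs by (metis N_def enumerates_def in_set_conv_nth)
      have "(\<Sum>w\<in>verts H. T u w * c w) = (\<Sum>k<N. T (vs ! i) (ws ! k) * v $ k)"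
        using i c by (simp add: sum_enumerates[OF ws] lenw)
      also have "\<dots> = (P *\<^sub>v v) $ i"
        using i v(1) by (simp add: P_def scalar_prod_def atLeast0LessThan)
      finally show "(\<Sum>w\<in>verts H. T u w * c w) = 0"
        using v(3) i by simp
    qed
    then have "v $ k = 0" if "k < N" for k
      using c[OF that] wsin[OF that] by simp
    then show False using v(1,2) by (auto intro!: eq_vecI)
  qed
  from det_non_zero_imp_unit[OF carr(3) this, unfolded Units_def, of "()"]
  obtain Q where Q: "Q \<in> carrier_mat N N" "Q * P = 1\<^sub>m N" "P * Q = 1\<^sub>m N"
    by (auto simp: ring_mat_def)
  have "A = A * (P * Q)" using carr Q by simp
  also have "\<dots> = A * P * Q" using carr Q(1) by (intro assoc_mult_mat[symmetric]) auto
  finally have "A = P * B * Q" using AP by simp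
  then have "similar_mat A B"
    using carr Q by (intro similar_matI[of _ _ P Q N]) auto
  then show ?thesis
    using vs ws by (auto simp: similar_graph_def A_def B_def)
qed

lemma verts_disjoint_union [simp]: "verts (G \<union>\<^sub>G H) = verts G <+> verts H"
  by (simp add: disjoint_union_def)

lemma adjacency_disjoint_union [simp]:
  "adjacency (G \<union>\<^sub>G H) (Inl x) (Inl y) = adjacency G x y"
  "adjacency (G \<union>\<^sub>G H) (Inr x') (Inr y') = adjacency H x' y'"
  "adjacency (G \<union>\<^sub>G H) (Inl x) (Inr y') = 0"
  "adjacency (G \<union>\<^sub>G H) (Inr x') (Inl y) = 0"
proof -
  \<comment> \<open>Edges of the union are images under \<open>Inl\<close> or \<open>Inr\<close>,
    and nonempty images of the two kinds never coincide.\<close>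
  have eq: "{Inl x, Inl y} = Inl ` {x, y}" "{Inr x', Inr y'} = Inr ` {x', y'}" by auto
  have "Inl ` {x, y} \<noteq> Inr ` e" "Inr ` {x', y'} \<noteq> Inl ` e'" for e e' by auto
  then have "{Inl x, Inl y} \<in> edges (G \<union>\<^sub>G H) \<longleftrightarrow> {x, y} \<in> edges G"
    "{Inr x', Inr y'} \<in> edges (G \<union>\<^sub>G H) \<longleftrightarrow> {x', y'} \<in> edges H"
    unfolding eq by (auto simp: disjoint_union_def inj_image_eq_iff simp del: image_insert)
  moreover have "weight (G \<union>\<^sub>G H) {Inl x, Inl y} = weight G {x, y}"
    "weight (G \<union>\<^sub>G H) {Inr x', Inr y'} = weight H {x', y'}"
    unfolding eq by (auto simp: disjoint_union_def inj_vimage_image_eq simp del: image_insert)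
  ultimately show "adjacency (G \<union>\<^sub>G H) (Inl x) (Inl y) = adjacency G x y"
    "adjacency (G \<union>\<^sub>G H) (Inr x') (Inr y') = adjacency H x' y'"
    by (simp_all add: adjacency_def)
  have "{Inl x, Inr y'} \<noteq> Inl ` e" "{Inl x, Inr y'} \<noteq> Inr ` e'"
    "{Inr x', Inl y} \<noteq> Inl ` e" "{Inr x', Inl y} \<noteq> Inr ` e'" for e e' by auto
  then show "adjacency (G \<union>\<^sub>G H) (Inl x) (Inr y') = 0"
    "adjacency (G \<union>\<^sub>G H) (Inr x') (Inl y) = 0"
    by (auto simp: adjacency_def disjoint_union_def)
qed

lemma intertwines_disjoint_union:
  assumes "finite (verts H)" "finite (verts K)" "intertwines G H S" "intertwines G K T"
  shows "intertwines G (H \<union>\<^sub>G K) (\<lambda>u. case_sum (S u) (T u))"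
  using assms by (auto simp: intertwines_def sum.Plus)

subsection \<open>Commutators with the square of the path matrix\<close>

text \<open>Square matrices of order \<open>N\<close>, given by their entries at indices below \<open>N\<close>.\<close>

definition mmult :: "nat \<Rightarrow> (nat \<Rightarrow> nat \<Rightarrow> real) \<Rightarrow> (nat \<Rightarrow> nat \<Rightarrow> real) \<Rightarrow> nat \<Rightarrow> nat \<Rightarrow> real" where
  "mmult N F G i j = (\<Sum>k<N. F i k * G k j)"

lemma mmult_assoc: "mmult N (mmult N F G) H = mmult N F (mmult N G H)"
proof (intro ext)
  fix i j
  have "mmult N (mmult N F G) H i j = (\<Sum>l<N. \<Sum>k<N. F i k * G k l * H l j)"
    by (simp add: mmult_def sum_distrib_right)
  also have "\<dots> = (\<Sum>k<N. \<Sum>l<N. F i k * G k l * H l j)"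
    by (rule sum.swap)
  also have "\<dots> = mmult N F (mmult N G H) i j"
    by (simp add: mmult_def sum_distrib_left mult.assoc)
  finally show "mmult N (mmult N F G) H i j = mmult N F (mmult N G H) i j" .
qed

lemma mmult_cong:
  assumes "\<And>k. k < N \<Longrightarrow> F i k = F' i k" "\<And>k. k < N \<Longrightarrow> G k j = G' k j"
  shows "mmult N F G i j = mmult N F' G' i j"
  using assms by (simp add: mmult_def)

lemma mmult_diff:
  "mmult N F (\<lambda>i j. G i j - H i j) i j = mmult N F G i j - mmult N F H i j"
  "mmult N (\<lambda>i j. G i j - H i j) F i j = mmult N G F i j - mmult N H F i j"
  by (simp_all add: mmult_def algebra_simps sum_subtractf)

lemma mmult_sum:
  "mmult N F (\<lambda>i j. \<Sum>x\<in>X. G x i j * c x) i j = (\<Sum>x\<in>X. mmult N F (G x) i j * c x)"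
  "mmult N (\<lambda>i j. \<Sum>x\<in>X. G x i j * c x) F i j = (\<Sum>x\<in>X. mmult N (G x) F i j * c x)"
  unfolding mmult_def
  by (simp_all add: sum_distrib_left sum_distrib_right mult_ac sum.swap[of _ X])

text \<open>This is the infinite path \<open>0, 1, 2, ...\<close>; the sum in \<open>mmult N\<close>
  truncates it to \<open>N\<close> vertices.\<close>

definition path_mat :: "nat \<Rightarrow> nat \<Rightarrow> real" where
  "path_mat i j = (if i = Suc j \<or> j = Suc i then 1 else 0)"

lemma path_mat_sym: "path_mat i j = path_mat j i"
  by (auto simp: path_mat_def)

lemma sum_path_mat:
  assumes "j < N"
  shows "(\<Sum>l<N. path_mat j l * f l) =
    (if j = 0 then 0 else f (j - 1)) + (if Suc j < N then f (Suc j) else 0)"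
proof -
  \<comment> \<open>For \<open>j = 0\<close> the truncated \<open>j - 1\<close> is \<open>0\<close>,
    so the inner conditional removes a left neighbour that does not exist.\<close>
  have "path_mat j l * f l = (if l = j - 1 then if j = 0 then 0 else f (j - 1) else 0)
      + (if l = Suc j then f (Suc j) else 0)" for l
    by (auto simp: path_mat_def)
  then show ?thesis using assms by (simp add: sum.distrib)
qed

lemma path_mmult:
  assumes "i < N"
  shows "mmult N path_mat F i j =
    (if i = 0 then 0 else F (i - 1) j) + (if Suc i < N then F (Suc i) j else 0)"
  unfolding mmult_def by (rule sum_path_mat[OF assms])

lemma mmult_path:
  assumes "j < N"
  shows "mmult N F path_mat i j =
    (if j = 0 then 0 else F i (j - 1)) + (if Suc j < N then F i (Suc j) else 0)"
  using sum_path_mat[OF assms, of "F i"] by (simp add: mmult_def path_mat_sym[of _ j] mult.commute)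

text \<open>Two steps from \<open>i\<close> end at distance two or return to \<open>i\<close>; each
  neighbour of \<open>i\<close> contributes one conditional copy of \<open>F i j\<close>.\<close>

lemma path_path_mmult:
  assumes "i < N"
  shows "mmult N path_mat (mmult N path_mat F) i j =
    (if i < 2 then 0 else F (i - 2) j) + (if i = 0 then 0 else F i j)
    + ((if Suc i < N then F i j else 0) + (if i + 2 < N then F (i + 2) j else 0))"
  using assms by (cases i; cases "i - 1") (auto simp: path_mmult)

lemma mmult_path_path:
  assumes "j < N"
  shows "mmult N (mmult N F path_mat) path_mat i j =
    (if j < 2 then 0 else F i (j - 2)) + (if j = 0 then 0 else F i j)
    + ((if Suc j < N then F i j else 0) + (if j + 2 < N then F i (j + 2) else 0))"
  using assms by (cases j; cases "j - 1") (auto simp: mmult_path)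

definition comm :: "nat \<Rightarrow> (nat \<Rightarrow> nat \<Rightarrow> real) \<Rightarrow> (nat \<Rightarrow> nat \<Rightarrow> real) \<Rightarrow> nat \<Rightarrow> nat \<Rightarrow> real" where
  "comm N H M i j = mmult N H M i j - mmult N M H i j"

text \<open>Left and right multiplication by a symmetric matrix are both self-adjoint for the
  Frobenius inner product.\<close>

lemma comm_self_adjoint:
  assumes sym: "\<And>i j. H i j = H j i"
  shows "(\<Sum>i<N. \<Sum>j<N. comm N H M i j * K i j) = (\<Sum>i<N. \<Sum>j<N. M i j * comm N H K i j)"
proof -
  have "(\<Sum>i<N. \<Sum>j<N. mmult N H M i j * K i j) = (\<Sum>i<N. \<Sum>j<N. \<Sum>k<N. H i k * M k j * K i j)"
    by (simp add: mmult_def sum_distrib_right)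
  also have "\<dots> = (\<Sum>j<N. \<Sum>i<N. \<Sum>k<N. H i k * M k j * K i j)" by (rule sum.swap)
  also have "\<dots> = (\<Sum>j<N. \<Sum>k<N. \<Sum>i<N. H i k * M k j * K i j)"
    by (intro sum.cong refl sum.swap)
  also have "\<dots> = (\<Sum>k<N. \<Sum>j<N. \<Sum>i<N. H i k * M k j * K i j)" by (rule sum.swap)
  also have "\<dots> = (\<Sum>k<N. \<Sum>j<N. M k j * mmult N H K k j)"
    unfolding mmult_def sum_distrib_left by (intro sum.cong refl) (simp add: sym[of _ k for k] mult_ac)
  finally have 1: "(\<Sum>i<N. \<Sum>j<N. mmult N H M i j * K i j) = (\<Sum>k<N. \<Sum>j<N. M k j * mmult N H K k j)" .
  have "(\<Sum>i<N. \<Sum>j<N. mmult N M H i j * K i j) = (\<Sum>i<N. \<Sum>j<N. \<Sum>k<N. M i k * H k j * K i j)"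
    by (simp add: mmult_def sum_distrib_right)
  also have "\<dots> = (\<Sum>i<N. \<Sum>k<N. \<Sum>j<N. M i k * H k j * K i j)"
    by (intro sum.cong refl sum.swap)
  also have "\<dots> = (\<Sum>i<N. \<Sum>k<N. M i k * mmult N K H i k)"
    unfolding mmult_def sum_distrib_left by (intro sum.cong refl) (subst sym, simp add: mult_ac)
  finally have 2: "(\<Sum>i<N. \<Sum>j<N. mmult N M H i j * K i j) = (\<Sum>i<N. \<Sum>k<N. M i k * mmult N K H i k)" .
  show ?thesis
    using 1 2 by (simp add: comm_def left_diff_distrib right_diff_distrib sum_subtractf)
qed

text \<open>The squared norm of \<open>[H, M]\<close> is the inner product of \<open>M\<close> with
  \<open>[H, [H, M]]\<close>.\<close>

lemma comm_comm_eq_0: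
  assumes sym: "\<And>i j. H i j = H j i"
    and "\<And>i j. \<lbrakk>i < N; j < N\<rbrakk> \<Longrightarrow> comm N H (comm N H M) i j = 0"
    and "i < N" "j < N"
  shows "comm N H M i j = 0"
proof -
  have "(\<Sum>i<N. \<Sum>j<N. comm N H M i j * comm N H M i j) = 0"
    by (subst comm_self_adjoint[OF sym]) (simp add: assms(2))
  then have "\<forall>i<N. \<forall>j<N. comm N H M i j * comm N H M i j = 0"
    by (simp add: sum_nonneg_eq_0_iff sum_nonneg)
  then show ?thesis using assms by simp
qed

abbreviation path_mat2 :: "nat \<Rightarrow> nat \<Rightarrow> nat \<Rightarrow> real" where
  "path_mat2 N \<equiv> mmult N path_mat path_mat"

lemma path_mat2_sym: "path_mat2 N i j = path_mat2 N j i"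
  by (simp add: mmult_def path_mat_sym[of i] path_mat_sym[of j] mult.commute)

text \<open>The diagonals of \<open>M\<close> vanish one after the other, starting from the main diagonal: once all
  shorter distances are done, the commutation relation says that the next diagonal is constant
  in steps of two, with initial value zero.\<close>

lemma commutes_path_mat2_antisym_eq_0:
  assumes anti: "\<And>i j. M i j = - M j i"
    and black: "\<And>i j. odd (i + j) \<Longrightarrow> M i j = 0"
    and comm: "\<And>i j. \<lbrakk>i < N; j < N\<rbrakk> \<Longrightarrow> comm N (path_mat2 N) M i j = 0"
    and "i < N" "j < N"
  shows "M i j = 0"
proof -
  have eq: "mmult N path_mat (mmult N path_mat M) i j = mmult N (mmult N M path_mat) path_mat i j"
    if "i < N" "j < N" for i j
    using comm[OF that] by (simp add: comm_def mmult_assoc)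
  have diag0: "M i i = 0" for i using anti[of i i] by simp
  have *: "j + d < N \<Longrightarrow> M (j + d) j = 0" for d j
  proof (induction d arbitrary: j rule: less_induct)
    case (less d)
    have outer: "M (j + e) j = 0" if "e < d" "j + e < N" for e j
      using less.IH that by blast
    consider "d = 0" | "odd d" | e where "d = e + 2" "even e"
    proof (cases "d < 2")
      case True with that(1,2) show thesis by (auto simp: less_2_cases_iff)
    next
      case False
      then obtain e where "d = e + 2" by (metis add.commute le_Suc_ex not_less)
      with that(2,3) show thesis by (cases "even e") auto
    qed
    then show ?case
    proof cases
      case 1 then show ?thesis by (simp add: diag0)
    next
      case 2 then show ?thesis by (intro black) auto
    next
      case 3
      from less.prems show ?thesis
      proof (induction j rule: less_induct)
        case (less j)
        define i where "i = j + e"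
        have i: "i + 2 < N" "j + 2 \<le> N" using less.prems 3 by (auto simp: i_def)
        \<comment> \<open>This entry has the shorter distance \<open>e\<close>, so the diagonal
          terms of \<open>A\<^sup>2\<close>, which may differ at \<open>i\<close> and
          \<open>j\<close>, drop out.\<close>
        have "M i j = 0" unfolding i_def using i 3 by (intro outer) (auto simp: i_def)
        then have E: "(if i < 2 then 0 else M (i - 2) j) + M (i + 2) j
          = (if j < 2 then 0 else M i (j - 2)) + (if j + 2 < N then M i (j + 2) else 0)"
          using eq[of i j] i by (simp add: path_path_mmult mmult_path_path cong: if_cong)
        have low: "M i (j - 2) = 0" if "2 \<le> j"
        proof -
          obtain k where "j = k + 2" using \<open>2 \<le> j\<close> by (metis add.commute le_Suc_ex)
          then show ?thesis using less.IH[of k] less.prems 3 by (simp add: i_def)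
        qed
        have "M (i + 2) j = 0"
        proof (cases "e = 0")
          \<comment> \<open>At the main diagonal both sides of \<open>E\<close> contain the sought
            entry, with opposite signs by antisymmetry.\<close>
          case True
          then show ?thesis
            using E low i anti[of "j - 2" j] anti[of j "j + 2"] by (simp add: i_def split: if_splits)
        next
          case False
          then have "2 \<le> e" using 3 by presburger
          then obtain f where f: "e = f + 2" by (metis add.commute le_Suc_ex)
          \<comment> \<open>The entries \<open>M (i - 2) j\<close> and \<open>M i (j + 2)\<close> of
            \<open>E\<close> lie at the shorter distance \<open>f\<close>.\<close>
          have "M (j + f) j = 0" "M (j + 2 + f) (j + 2) = 0"
            using outer[of f j] outer[of f "j + 2"] i 3 f by (auto simp: i_def)
          then show ?thesis
            using E low i f by (simp add: i_def split: if_splits)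
        qed
        then show ?case using 3 by (simp add: i_def)
      qed
    qed
  qed
  show ?thesis
  proof (cases "j \<le> i")
    case True then show ?thesis using *[of j "i - j"] assms(4) by simp
  next
    case False then show ?thesis using *[of i "j - i"] assms(5) anti[of i j] by simp
  qed
qed

subsection \<open>Chebyshev polynomials of the path matrix\<close>

text \<open>\<open>cheb N k\<close> is \<open>U\<^sub>k(A / 2)\<close>, where \<open>U\<^sub>k\<close> is the Chebyshev polynomial of the second kind.\<close>

fun cheb :: "nat \<Rightarrow> nat \<Rightarrow> nat \<Rightarrow> nat \<Rightarrow> real" where
  "cheb N 0 = (\<lambda>i j. if i = j then 1 else 0)"
| "cheb N (Suc 0) = path_mat"
| "cheb N (Suc (Suc k)) = (\<lambda>i j. mmult N path_mat (cheb N (Suc k)) i j - cheb N k i j)"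

lemma cheb_commute:
  "\<lbrakk>i < N; j < N\<rbrakk> \<Longrightarrow> mmult N path_mat (cheb N k) i j = mmult N (cheb N k) path_mat i j"
proof (induction N k arbitrary: i j rule: cheb.induct)
  case (1 N)
  then show ?case by (simp add: mmult_def if_distrib if_distribR cong: if_cong)
next
  case (3 N k)
  have "mmult N path_mat (mmult N path_mat (cheb N (Suc k))) i j
      = mmult N (mmult N path_mat (cheb N (Suc k))) path_mat i j"
    unfolding mmult_assoc by (rule mmult_cong) (use 3 in simp_all)
  then show ?case using 3 by (simp add: mmult_diff)
qed simp

text \<open>A product of commuting symmetric matrices is symmetric.\<close>

lemma cheb_sym: "\<lbrakk>i < N; j < N\<rbrakk> \<Longrightarrow> cheb N k i j = cheb N k j i"
proof (induction N k arbitrary: i j rule: cheb.induct)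
  case (3 N k)
  have "mmult N path_mat (cheb N (Suc k)) i j = mmult N (cheb N (Suc k)) path_mat j i"
    using 3 unfolding mmult_def by (intro sum.cong) (simp_all add: path_mat_sym[of i] mult.commute)
  then show ?case using 3 cheb_commute[of j N i "Suc k"] by simp
qed (simp_all add: path_mat_sym)

text \<open>\<open>U\<^sub>k\<close> has the parity of \<open>k\<close> as a polynomial, and
  \<open>A\<close> changes the parity of the index.\<close>

lemma cheb_parity: "odd (i + j + k) \<Longrightarrow> cheb N k i j = 0"
proof (induction N k arbitrary: i j rule: cheb.induct)
  case (3 N k)
  have "path_mat i l * cheb N (Suc k) l j = 0" for l
  proof (cases "path_mat i l = 0")
    case False
    then have "odd (l + j + Suc k)"
      using "3.prems" by (auto simp: path_mat_def split: if_splits)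
    then show ?thesis using "3.IH"(1) by simp
  qed simp
  then have "mmult N path_mat (cheb N (Suc k)) i j = 0"
    unfolding mmult_def by (intro sum.neutral ballI)
  then show ?case using 3 by simp
qed (auto simp: path_mat_def)

text \<open>The Chebyshev recursion walks along the path: \<open>cheb N k\<close> sends the unit
  vector of vertex \<open>0\<close> to that of vertex \<open>k\<close>, and to zero when
  \<open>k = N\<close>.\<close>

lemma cheb_row_0: "\<lbrakk>k \<le> N; 0 < N; j < N\<rbrakk> \<Longrightarrow> cheb N k 0 j = (if j = k then 1 else 0)"
proof (induction N k arbitrary: j rule: cheb.induct)
  case (3 N k)
  \<comment> \<open>Commuting puts row \<open>0\<close> of the polynomial, known by induction, on
    the left.\<close>
  have "mmult N path_mat (cheb N (Suc k)) 0 j = mmult N (cheb N (Suc k)) path_mat 0 j"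
    using 3 by (intro cheb_commute) auto
  also have "\<dots> = (\<Sum>l<N. if l = Suc k then path_mat l j else 0)"
    using 3 unfolding mmult_def by (intro sum.cong) auto
  also have "\<dots> = path_mat (Suc k) j" using 3 by simp
  finally show ?case using 3 by (auto simp: path_mat_def)
qed (auto simp: path_mat_def)

text \<open>This is the Cayley--Hamilton theorem for the path matrix; a matrix that commutes with \<open>A\<close> is
  determined by its first row.\<close>

lemma cheb_eq_0:
  assumes "i < N" "j < N"
  shows "cheb N N i j = 0"
  using assms
proof (induction i arbitrary: j rule: less_induct)
  case (less i)
  show ?case
  proof (cases i)
    case 0
    then show ?thesis using less.prems by (simp add: cheb_row_0)
  next
    case (Suc m)
    have "mmult N path_mat (cheb N N) m j = mmult N (cheb N N) path_mat m j"
      using less.prems Suc by (intro cheb_commute) auto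
    then show ?thesis
      using less Suc by (auto simp: path_mmult mmult_path split: if_splits)
  qed
qed

text \<open>Twice \<open>x U_k = U_(k+1) + U_(k-1)\<close>, with \<open>U_(-1) = 0\<close>; for
  \<open>k = 0\<close> this leaves only one return to \<open>U_k\<close>.\<close>

lemma path_cheb_path:
  assumes "i < N" "j < N"
  shows "mmult N path_mat (mmult N (cheb N k) path_mat) i j =
    (if k = 0 then cheb N 0 i j else if k = 1 then 2 * cheb N 1 i j
     else 2 * cheb N k i j + cheb N (k - 2) i j) + cheb N (k + 2) i j"
proof -
  have "mmult N path_mat (mmult N (cheb N k) path_mat) i j
      = mmult N path_mat (mmult N path_mat (cheb N k)) i j"
    by (rule mmult_cong) (simp_all add: assms cheb_commute)
  also have "\<dots> = (if k = 0 then cheb N 0 i j else if k = 1 then 2 * cheb N 1 i j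
     else 2 * cheb N k i j + cheb N (k - 2) i j) + cheb N (k + 2) i j"
  proof (cases k)
    case 0
    have "mmult N path_mat (mmult N path_mat (cheb N 0)) i j = path_mat2 N i j"
      by (rule mmult_cong) (simp_all add: mmult_def if_distrib assms cong: if_cong)
    with 0 show ?thesis by (simp add: numeral_2_eq_2)
  next
    case (Suc m)
    have step: "mmult N path_mat (cheb N (Suc l)) a b = cheb N (Suc (Suc l)) a b + cheb N l a b" for l a b
      by simp
    have "mmult N path_mat (mmult N path_mat (cheb N (Suc m))) i j
        = mmult N path_mat (\<lambda>i j. cheb N (Suc (Suc m)) i j + cheb N m i j) i j"
      by (rule mmult_cong) (simp_all only: step)
    also have "\<dots> = mmult N path_mat (cheb N (Suc (Suc m))) i j + mmult N path_mat (cheb N m) i j"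
      by (simp only: mmult_def distrib_left sum.distrib)
    also have "\<dots> = cheb N (Suc (Suc (Suc m))) i j + cheb N (Suc m) i j + mmult N path_mat (cheb N m) i j"
      by (simp only: step)
    finally have *: "mmult N path_mat (mmult N path_mat (cheb N k)) i j
        = cheb N (k + 2) i j + cheb N k i j + mmult N path_mat (cheb N m) i j"
      using Suc by (simp only: add_2_eq_Suc')
    show ?thesis
    proof (cases m)
      case 0
      have "mmult N path_mat (cheb N 0) i j = cheb N 1 i j"
        using assms by (simp add: mmult_def if_distrib cong: if_cong)
      then show ?thesis unfolding * using Suc 0 by simp
    next
      case (Suc p)
      then have "mmult N path_mat (cheb N m) i j = cheb N k i j + cheb N (k - 2) i j"
        using \<open>k = Suc m\<close> by simp
      then show ?thesis
        unfolding * using \<open>k = Suc m\<close> Suc by (simp del: cheb.simps)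
    qed
  qed
  finally show ?thesis .
qed

subsection \<open>The intertwining maps\<close>

text \<open>Squares sharing a corner differ by at most one in each coordinate; distinct black ones
  must then differ in both.\<close>

lemma adjacency_MD:
  assumes "(i, j) \<in> black_squares (2 * n)" "(k, l) \<in> black_squares (2 * n)"
  shows "adjacency (MD n) (i, j) (k, l) = path_mat i k * path_mat j l"
proof -
  have "{(i, j), (k, l)} \<in> edges (MD n) \<longleftrightarrow>
      (i, j) \<noteq> (k, l) \<and> corners (i, j) \<inter> corners (k, l) \<noteq> {}"
    using assms unfolding MD_def by (force simp: doubleton_eq_iff simp del: corners.simps)
  also have "corners (i, j) \<inter> corners (k, l) = ({i, Suc i} \<inter> {k, Suc k}) \<times> ({j, Suc j} \<inter> {l, Suc l})"
  proof -
    have "corners (a, b) = {a, Suc a} \<times> {b, Suc b}" for a b by auto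
    then show ?thesis by (simp only: Times_Int_Times)
  qed
  also have "(i, j) \<noteq> (k, l) \<and> \<dots> \<noteq> {} \<longleftrightarrow>
      (i, j) \<noteq> (k, l) \<and> (i = k \<or> i = Suc k \<or> k = Suc i) \<and> (j = l \<or> j = Suc l \<or> l = Suc j)"
    by (simp add: times_eq_iff) linarith
  also have "\<dots> \<longleftrightarrow> (i = Suc k \<or> k = Suc i) \<and> (j = Suc l \<or> l = Suc j)"
    using assms by (auto simp: black_squares_def)
  finally show ?thesis
    by (auto simp: adjacency_def MD_def path_mat_def)
qed

lemma finite_black_squares [simp]: "finite (black_squares m)"
  by (rule finite_subset[of _ "{..<m} \<times> {..<m}"]) (auto simp: black_squares_def)

lemma verts_MD [simp]: "verts (MD n) = black_squares (2 * n)"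
  by (simp add: MD_def)

lemma sum_adjacency_MD:
  assumes "(i, j) \<in> black_squares (2 * n)"
  shows "(\<Sum>v\<in>black_squares (2 * n). adjacency (MD n) (i, j) v * (case v of (k, l) \<Rightarrow> F k l)) =
    mmult (2 * n) path_mat (mmult (2 * n) F path_mat) i j"
proof -
  let ?N = "2 * n"
  have "(\<Sum>v\<in>black_squares ?N. adjacency (MD n) (i, j) v * (case v of (k, l) \<Rightarrow> F k l)) =
      (\<Sum>(k, l)\<in>black_squares ?N. path_mat i k * (F k l * path_mat l j))"
    using adjacency_MD[OF assms] by (intro sum.cong) (auto simp: path_mat_sym[of j])
  \<comment> \<open>A step in both coordinates preserves the colour, so white squares add only
    zeros.\<close>
  also have "\<dots> = (\<Sum>(k, l)\<in>{..<?N} \<times> {..<?N}. path_mat i k * (F k l * path_mat l j))"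
    using assms by (intro sum.mono_neutral_left) (auto simp: black_squares_def path_mat_def split: if_splits)
  also have "\<dots> = mmult ?N path_mat (mmult ?N F path_mat) i j"
    by (simp add: mmult_def sum_distrib_left sum.cartesian_product)
  finally show ?thesis .
qed

lemma intertwines_MD:
  assumes "\<And>i j w. \<lbrakk>i < 2 * n; j < 2 * n; w \<in> verts H\<rbrakk> \<Longrightarrow>
    mmult (2 * n) path_mat (mmult (2 * n) (T w) path_mat) i j = (\<Sum>x\<in>verts H. T x i j * adjacency H x w)"
  shows "intertwines (MD n) H (\<lambda>(i, j) w. T w i j)"
  unfolding intertwines_def
proof (intro ballI)
  fix u w assume u: "u \<in> verts (MD n)" and w: "w \<in> verts H"
  obtain i j where ij: "u = (i, j)" by fastforce
  with u have "(i, j) \<in> black_squares (2 * n)" "i < 2 * n" "j < 2 * n"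
    by (auto simp: black_squares_def)
  then show "(\<Sum>v\<in>verts (MD n). adjacency (MD n) u v * (case v of (i, j) \<Rightarrow> \<lambda>w. T w i j) w) =
      (\<Sum>x\<in>verts H. (case u of (i, j) \<Rightarrow> \<lambda>w. T w i j) x * adjacency H x w)"
    using assms[OF _ _ w] sum_adjacency_MD[of i j n "T w"] by (simp add: ij split_beta)
qed

section \<open>Antisymmetric matrices and the two halved diamonds\<close>

lemma verts_HMD: "verts (HMD n) = {(i, j). i < 2 * n \<and> j < 2 * n \<and> even (i + j) \<and> i \<le> j}"
  by (auto simp: HMD_def induced_subgraph_def black_squares_def)

lemma finite_verts_HMD [simp]: "finite (verts (HMD n))"
  by (simp add: HMD_def induced_subgraph_def)

lemma adjacency_HMD:
  assumes "(i, j) \<in> verts (HMD n)" "(k, l) \<in> verts (HMD n)"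
  shows "adjacency (HMD n) (i, j) (k, l) = path_mat i k * path_mat j l"
proof -
  have "adjacency (HMD n) (i, j) (k, l) = adjacency (MD n) (i, j) (k, l)"
    using assms by (auto simp: verts_HMD adjacency_def HMD_def induced_subgraph_def)
  also have "\<dots> = path_mat i k * path_mat j l"
    using assms by (intro adjacency_MD) (auto simp: verts_HMD black_squares_def)
  finally show ?thesis .
qed

text \<open>The shift \<open>(i, j) \<mapsto> (i, j + 2)\<close> identifies \<open>HMD (n - 1)\<close> with the black squares of \<open>MD n\<close>
  strictly above the diagonal.\<close>

fun skew_unit :: "square \<Rightarrow> nat \<Rightarrow> nat \<Rightarrow> real" where
  "skew_unit (i, j) k l =
     (if k = i \<and> l = j + 2 then 1 else 0) - (if k = j + 2 \<and> l = i then 1 else 0)"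

text \<open>The supports are disjoint, so at most one term survives. Distinct indices of equal
  parity differ by at least two, so the subtraction of \<open>2\<close> is exact.\<close>

lemma sum_skew_unit:
  assumes "k < 2 * n" "l < 2 * n"
  shows "(\<Sum>x\<in>verts (HMD (n - 1)). skew_unit x k l * c x) =
    (if odd (k + l) \<or> k = l then 0 else if k < l then c (k, l - 2) else - c (l, k - 2))"
proof -
  let ?V = "verts (HMD (n - 1))"
  consider "odd (k + l) \<or> k = l" | "even (k + l)" "k < l" | "even (k + l)" "l < k" by linarith
  then show ?thesis
  proof cases
    case 1
    then have "skew_unit x k l = 0" if "x \<in> ?V" for x
      using that by (cases x) (auto simp: verts_HMD)
    then show ?thesis using 1 by simp
  next
    case 2
    then have l: "k + 2 \<le> l" by presburger
    have "skew_unit x k l * c x = (if x = (k, l - 2) then c (k, l - 2) else 0)" if "x \<in> ?V" for x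
      using that l by (cases x) (auto simp: verts_HMD)
    moreover have "(k, l - 2) \<in> ?V" using assms 2 l by (auto simp: verts_HMD)
    ultimately show ?thesis using 2 by simp
  next
    case 3
    then have l: "l + 2 \<le> k" by presburger
    have "skew_unit x k l * c x = (if x = (l, k - 2) then - c (l, k - 2) else 0)" if "x \<in> ?V" for x
      using that l by (cases x) (auto simp: verts_HMD)
    moreover have "(l, k - 2) \<in> ?V" using assms 3 l by (auto simp: verts_HMD)
    ultimately show ?thesis using 3 by simp
  qed
qed

text \<open>Antisymmetric matrices vanish on the diagonal, so above it only neighbours strictly
  above it contribute.\<close>

lemma path_skew_unit_path:
  assumes "k < 2 * n" "l < 2 * n" and w: "w \<in> verts (HMD (n - 1))"
  shows "mmult (2 * n) path_mat (mmult (2 * n) (skew_unit w) path_mat) k l =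
    (\<Sum>x\<in>verts (HMD (n - 1)). skew_unit x k l * adjacency (HMD (n - 1)) x w)"
proof -
  let ?N = "2 * n"
  obtain i j where ij: "w = (i, j)" by fastforce
  have i: "i < ?N" "j + 2 < ?N" "i \<le> j" "even (i + j)" using w ij by (auto simp: verts_HMD)
  have unit: "mmult ?N path_mat (mmult ?N (\<lambda>p q. if p = a \<and> q = b then 1 else 0) path_mat) k l
      = path_mat k a * path_mat b l" if "a < ?N" "b < ?N" for a b
  proof -
    have row: "mmult ?N (\<lambda>p q. if p = a \<and> q = b then 1 else 0) path_mat p l = (if p = a then path_mat b l else 0)" for p
      using that by (cases "p = a") (simp_all add: mmult_def if_distrib if_distribR cong: if_cong)
    then show ?thesis
      unfolding mmult_def[of _ path_mat] row using that by (simp add: if_distrib cong: if_cong)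
  qed
  have "mmult ?N path_mat (mmult ?N (skew_unit w) path_mat) k l
      = path_mat k i * path_mat (j + 2) l - path_mat k (j + 2) * path_mat i l"
  proof -
    have "skew_unit w = (\<lambda>p q. (if p = i \<and> q = j + 2 then 1 else 0) - (if p = j + 2 \<and> q = i then 1 else 0))"
      by (intro ext) (simp add: ij)
    moreover have "mmult ?N (\<lambda>p q. F p q - G p q) path_mat
        = (\<lambda>p q. mmult ?N F path_mat p q - mmult ?N G path_mat p q)" for F G
      by (intro ext) (rule mmult_diff)
    ultimately show ?thesis using i unit by (simp add: mmult_diff)
  qed
  also have "\<dots> = (if odd (k + l) \<or> k = l then 0
      else if k < l then path_mat k i * path_mat (l - 2) j else - (path_mat l i * path_mat (k - 2) j))"
  proof -
    have par: "path_mat a b = 0" if "even (a + b)" for a b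
      using that by (auto simp: path_mat_def)
    \<comment> \<open>The mirror term vanishes: adjacency to \<open>j + 2\<close> forces
      \<open>j + 1 \<le> a\<close>, adjacency to \<open>i\<close> forces
      \<open>b \<le> i + 1 \<le> j + 1\<close>.\<close>
    have far: "path_mat a (j + 2) * path_mat i b = 0" if "a + 2 \<le> b" for a b
      using that i(3) unfolding path_mat_def by (auto split: if_splits)
    have shift: "path_mat (a + 2) (b + 2) = path_mat a b" for a b
      by (simp add: path_mat_def)
    consider "odd (k + l)" | "k = l" | "even (k + l)" "k < l" | "even (k + l)" "l < k" by linarith
    then show ?thesis
    proof cases
      case 1
      then show ?thesis
        using i par[of k i] par[of "j + 2" l] par[of k "j + 2"] par[of i l]
        by (cases "even (k + i)") auto
    next
      case 2
      then show ?thesis using path_mat_sym[of l i] path_mat_sym[of "j + 2" l] by simp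
    next
      case 3
      then have "k + 2 \<le> l" by presburger
      moreover from this obtain m where "l = m + 2" by atomize_elim presburger
      ultimately have "path_mat (j + 2) l = path_mat (l - 2) j" "path_mat k (j + 2) * path_mat i l = 0"
        using shift[of j m] path_mat_sym[of j m] far[of k l] by simp_all
      moreover have "(odd (k + l) \<or> k = l) = False" "(k < l) = True" using 3 by auto
      ultimately show ?thesis by (simp only: if_True if_False diff_zero)
    next
      case 4
      then have "l + 2 \<le> k" by presburger
      moreover from this obtain m where "k = m + 2" by atomize_elim presburger
      ultimately have "path_mat k (j + 2) = path_mat (k - 2) j" "path_mat k i * path_mat (j + 2) l = 0"
        using shift[of m j] far[of l k] path_mat_sym[of k i] path_mat_sym[of "j + 2" l]
        by (simp_all add: mult.commute)
      moreover have "(odd (k + l) \<or> k = l) = False" "(k < l) = False" using 4 by auto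
      ultimately show ?thesis
        by (simp only: if_False diff_0 path_mat_sym[of i l] mult.commute[of "path_mat l i"])
    qed
  qed
  also have "\<dots> = (if odd (k + l) \<or> k = l then 0
      else if k < l then adjacency (HMD (n - 1)) (k, l - 2) w else - adjacency (HMD (n - 1)) (l, k - 2) w)"
  proof -
    have "(k, l - 2) \<in> verts (HMD (n - 1))" if "even (k + l)" "k < l"
    proof -
      have "k + 2 \<le> l" using that by presburger
      then show ?thesis using that assms by (auto simp: verts_HMD)
    qed
    moreover have "(l, k - 2) \<in> verts (HMD (n - 1))" if "even (k + l)" "l < k"
    proof -
      have "l + 2 \<le> k" using that by presburger
      then show ?thesis using that assms by (auto simp: verts_HMD)
    qed
    ultimately show ?thesis using w by (auto simp: ij adjacency_HMD)
  qed
  also have "\<dots> = (\<Sum>x\<in>verts (HMD (n - 1)). skew_unit x k l * adjacency (HMD (n - 1)) x w)"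
    by (rule sum_skew_unit[symmetric]) (use assms in auto)
  finally show ?thesis .
qed

text \<open>\<open>A\<close> commutes with its own square; hence the commutator carries the first
  copy of the halved diamond to the second.\<close>

lemma path_comm_path:
  "mmult N path_mat (mmult N (comm N (path_mat2 N) F) path_mat) i j
    = comm N (path_mat2 N) (mmult N path_mat (mmult N F path_mat)) i j"
proof -
  have "mmult N (comm N (path_mat2 N) F) path_mat = (\<lambda>i j.
      mmult N (mmult N (path_mat2 N) F) path_mat i j - mmult N (mmult N F (path_mat2 N)) path_mat i j)"
    by (intro ext) (simp add: comm_def[abs_def] mmult_diff)
  then show ?thesis by (simp add: comm_def mmult_diff mmult_assoc)
qed

lemma comm_sum:
  "comm N H (\<lambda>i j. \<Sum>x\<in>X. G x i j * c x) i j = (\<Sum>x\<in>X. comm N H (G x) i j * c x)"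
  by (simp add: comm_def mmult_sum left_diff_distrib sum_subtractf)

lemma comm_cong:
  assumes "\<And>i j. \<lbrakk>i < N; j < N\<rbrakk> \<Longrightarrow> F i j = G i j" "i < N" "j < N"
  shows "comm N H F i j = comm N H G i j"
  using assms by (simp add: comm_def mmult_def)

lemma path_comm_skew_unit_path:
  assumes "k < 2 * n" "l < 2 * n" and w: "w \<in> verts (HMD (n - 1))"
  shows "mmult (2 * n) path_mat (mmult (2 * n) (comm (2 * n) (path_mat2 (2 * n)) (skew_unit w)) path_mat) k l =
    (\<Sum>x\<in>verts (HMD (n - 1)). comm (2 * n) (path_mat2 (2 * n)) (skew_unit x) k l * adjacency (HMD (n - 1)) x w)"
  unfolding path_comm_path comm_sum[symmetric]
  by (rule comm_cong) (simp_all only: path_skew_unit_path assms)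

section \<open>Even Chebyshev polynomials and the two weighted paths\<close>

lemma verts_R_graph [simp]: "verts (R_graph n) = {..<n}" "verts (R'_graph n) = {..<n}"
  by (simp_all add: R_graph_def R'_graph_def Q_graph_def Q'_graph_def add_loops_def set_weight_def path_graph_def)

lemma adjacency_R_graph:
  assumes "i < n" "j < n"
  shows "adjacency (R_graph n) i j
    = path_mat j i + (if i = j then if Suc j = n then 1 else 2 else 0)"
  using assms
  by (auto simp: adjacency_def path_mat_def R_graph_def Q_graph_def add_loops_def
      set_weight_def path_graph_def doubleton_eq_iff)

text \<open>The alternating signs negate the path edges and fix the loops; the outer minus restores
  the edges and negates the loops.\<close>

lemma adjacency_R'_graph:
  assumes "i < n" "j < n"
  shows "adjacency (R'_graph n) i j = - ((- 1) ^ (i + j) * adjacency (R_graph n) i j)"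
  using assms
  by (auto simp: adjacency_def R_graph_def Q_graph_def R'_graph_def Q'_graph_def add_loops_def
      set_weight_def path_graph_def doubleton_eq_iff)

text \<open>The order is reversed: the last vertex carries \<open>U_0\<close>, whose single return
  is the loop of weight \<open>1\<close>, and the path stops at vertex \<open>0\<close> because
  \<open>cheb (2 * n) (2 * n)\<close> vanishes.\<close>

lemma path_cheb_path_R_graph:
  assumes "i < 2 * n" "j < 2 * n" "w < n"
  shows "mmult (2 * n) path_mat (mmult (2 * n) (cheb (2 * n) (2 * (n - 1 - w))) path_mat) i j =
    (\<Sum>x<n. cheb (2 * n) (2 * (n - 1 - x)) i j * adjacency (R_graph n) x w)"
proof -
  let ?C = "\<lambda>x. cheb (2 * n) (2 * (n - 1 - x)) i j"
  have "(\<Sum>x<n. ?C x * adjacency (R_graph n) x w)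
      = (\<Sum>x<n. path_mat w x * ?C x + (if x = w then (if Suc w = n then 1 else 2) * ?C w else 0))"
    using assms by (intro sum.cong) (auto simp: adjacency_R_graph algebra_simps)
  also have "\<dots> = (if w = 0 then 0 else ?C (w - 1)) + (if Suc w < n then ?C (Suc w) else 0)
      + (if Suc w = n then 1 else 2) * ?C w"
    using assms by (simp add: sum.distrib sum_path_mat)
  also have "\<dots> = mmult (2 * n) path_mat (mmult (2 * n) (cheb (2 * n) (2 * (n - 1 - w))) path_mat) i j"
  proof -
    define m where "m = n - 1 - w"
    have w: "w = n - 1 - m" "m < n" using assms by (auto simp: m_def)
    have up: "(if w = 0 then 0 else ?C (w - 1)) = cheb (2 * n) (2 * m + 2) i j"
    proof (cases "w = 0")
      case True
      then have "2 * m + 2 = 2 * n" using w by simp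
      then show ?thesis using True cheb_eq_0[OF assms(1,2)] by simp
    next
      case False
      then have "2 * (n - 1 - (w - 1)) = 2 * m + 2" using w by simp
      then show ?thesis using False by simp
    qed
    have down: "(if Suc w < n then ?C (Suc w) else 0) = (if m = 0 then 0 else cheb (2 * n) (2 * m - 2) i j)"
    proof -
      have "n - 1 - Suc w = m - 1" "Suc w < n \<longleftrightarrow> m \<noteq> 0" using w by auto
      then show ?thesis by (simp add: diff_mult_distrib2)
    qed
    have "Suc w = n \<longleftrightarrow> m = 0" using w by auto
    then show ?thesis
      unfolding up down m_def[symmetric] path_cheb_path[OF assms(1,2)] by simp
  qed
  finally show ?thesis by simp
qed

lemma path_mmult_alternating:
  "mmult N path_mat (\<lambda>i j. (- 1) ^ i * F i j) i j = - ((- 1) ^ i * mmult N path_mat F i j)"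
proof -
  have "path_mat i k * ((- 1) ^ k * F k j) = - ((- 1) ^ i * (path_mat i k * F k j))" for k
    by (auto simp: path_mat_def)
  then show ?thesis by (simp add: mmult_def sum_distrib_left sum_negf)
qed

lemma mmult_alternating:
  "mmult N (\<lambda>i j. (- 1) ^ i * F i j) G = (\<lambda>i j. (- 1) ^ i * mmult N F G i j)"
  by (intro ext) (simp add: mmult_def sum_distrib_left mult.assoc)

text \<open>Anticommutation yields the negated matrix of \<open>R_graph n\<close>; the signs
  \<open>(- 1) ^ w\<close> are the basis change from it to \<open>R'_graph n\<close>.\<close>

lemma path_cheb_path_R'_graph:
  assumes "i < 2 * n" "j < 2 * n" "w < n"
  shows "mmult (2 * n) path_mat (mmult (2 * n)
      (\<lambda>i j. (- 1) ^ i * ((- 1) ^ w * cheb (2 * n) (2 * (n - 1 - w)) i j)) path_mat) i j =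
    (\<Sum>x<n. (- 1) ^ i * ((- 1) ^ x * cheb (2 * n) (2 * (n - 1 - x)) i j) * adjacency (R'_graph n) x w)"
proof -
  let ?C = "\<lambda>x. cheb (2 * n) (2 * (n - 1 - x))"
  have scale: "mmult N F (\<lambda>i j. c * G i j) = (\<lambda>i j. c * mmult N F G i j)"
    "mmult N (\<lambda>i j. c * G i j) F = (\<lambda>i j. c * mmult N G F i j)" for N F G and c :: real
    by (intro ext, simp add: mmult_def sum_distrib_left mult_ac)+
  have "mmult (2 * n) path_mat (mmult (2 * n) (\<lambda>i j. (- 1) ^ i * ((- 1) ^ w * ?C w i j)) path_mat) i j
      = - ((- 1) ^ i * ((- 1) ^ w * mmult (2 * n) path_mat (mmult (2 * n) (?C w) path_mat) i j))"
    unfolding mmult_alternating path_mmult_alternating scale ..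
  also have "\<dots> = (\<Sum>x<n. - ((- 1) ^ i * ((- 1) ^ w * (?C x i j * adjacency (R_graph n) x w))))"
    unfolding path_cheb_path_R_graph[OF assms] by (simp add: sum_distrib_left sum_negf)
  also have "\<dots> = (\<Sum>x<n. (- 1) ^ i * ((- 1) ^ x * ?C x i j) * adjacency (R'_graph n) x w)"
  proof (intro sum.cong refl)
    fix x assume "x \<in> {..<n}"
    moreover have "(- 1) ^ x * (- 1) ^ (x + w) = ((- 1) ^ w :: real)"
      by (simp add: power_add mult.assoc[symmetric] flip: power_mult_distrib)
    ultimately show "- ((- 1) ^ i * ((- 1) ^ w * (?C x i j * adjacency (R_graph n) x w)))
        = (- 1) ^ i * ((- 1) ^ x * ?C x i j) * adjacency (R'_graph n) x w"
      using assms by (simp add: adjacency_R'_graph mult_ac)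
  qed
  finally show ?thesis .
qed

text \<open>The weighted paths account for the diagonal, the two shifted halved diamonds for the
  squares above and below it.\<close>

lemma card_black_squares: "card (black_squares (2 * n)) = 2 * card (verts (HMD (n - 1))) + 2 * n"
proof -
  let ?V = "verts (HMD (n - 1))"
  let ?U = "(\<lambda>(i, j). (i, j + 2)) ` ?V" and ?L = "(\<lambda>(i, j). (j + 2, i)) ` ?V"
    and ?D = "(\<lambda>i. (i, i)) ` {..<2 * n}"
  have "black_squares (2 * n) = ?U \<union> (?L \<union> ?D)"
  proof (intro equalityI subsetI)
    fix u assume "u \<in> black_squares (2 * n)"
    then obtain i j where u: "u = (i, j)" "i < 2 * n" "j < 2 * n" "even (i + j)"
      by (auto simp: black_squares_def)
    consider "i = j" | "i < j" | "j < i" by linarith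
    then show "u \<in> ?U \<union> (?L \<union> ?D)"
    proof cases
      case 1 then show ?thesis using u by auto
    next
      case 2
      then have "i + 2 \<le> j" using u(4) by presburger
      then have "u = (\<lambda>(i, j). (i, j + 2)) (i, j - 2)" "(i, j - 2) \<in> ?V"
        using u by (auto simp: verts_HMD)
      then show ?thesis by blast
    next
      case 3
      then have "j + 2 \<le> i" using u(4) by presburger
      then have "u = (\<lambda>(i, j). (j + 2, i)) (j, i - 2)" "(j, i - 2) \<in> ?V"
        using u by (auto simp: verts_HMD)
      then show ?thesis by blast
    qed
  qed (auto simp: black_squares_def verts_HMD)
  moreover have "?U \<inter> (?L \<union> ?D) = {}" "?L \<inter> ?D = {}" by (auto simp: verts_HMD)
  moreover have "card ?U = card ?V" "card ?L = card ?V" "card ?D = 2 * n"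
    by (subst card_image; auto simp: inj_on_def)+
  ultimately show ?thesis by (simp add: card_Un_disjoint)
qed

subsection \<open>Independence of the four pieces\<close>

lemma comm_path_mat2_cheb:
  assumes "i < N" "j < N"
  shows "comm N (path_mat2 N) (cheb N k) i j = 0"
proof -
  have "mmult N path_mat (mmult N path_mat (cheb N k)) i j = mmult N path_mat (mmult N (cheb N k) path_mat) i j"
    by (rule mmult_cong) (simp_all add: assms cheb_commute)
  also have "\<dots> = mmult N (mmult N (cheb N k) path_mat) path_mat i j"
    unfolding mmult_assoc[symmetric] by (rule mmult_cong) (simp_all add: assms cheb_commute)
  finally show ?thesis by (simp add: comm_def mmult_assoc)
qed

text \<open>Transposition turns \<open>H M\<close> into \<open>- M H\<close>.\<close>

lemma comm_antisym_sym:
  assumes H: "\<And>i j. H i j = H j i" and M: "\<And>i j. M i j = - M j i"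
  shows "comm N H M i j = comm N H M j i"
proof -
  have "mmult N H M i j = - mmult N M H j i" for i j
  proof -
    have "H i k * M k j = - (M j k * H k i)" for k
      using H[of i k] M[of k j] by simp
    then show ?thesis by (simp add: mmult_def sum_negf)
  qed
  from this[of i j] this[of j i] show ?thesis by (simp add: comm_def)
qed

lemma comm_parity:
  assumes H: "\<And>i j. odd (i + j) \<Longrightarrow> H i j = 0" and M: "\<And>i j. odd (i + j) \<Longrightarrow> M i j = 0"
    and "odd (i + j)"
  shows "comm N H M i j = 0"
proof -
  have "H i k * M k j = 0" "M i k * H k j = 0" for k
    using H[of i k] H[of k j] M[of k j] M[of i k] assms(3) by auto
  then show ?thesis by (simp only: comm_def mmult_def sum.neutral_const diff_self)
qed

lemma path_mat2_parity: "odd (i + j) \<Longrightarrow> path_mat2 N i j = 0"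
  unfolding mmult_def by (rule sum.neutral) (auto simp: path_mat_def)

lemma cheb_sum_eq_0:
  assumes zero: "\<And>k l. \<lbrakk>k < 2 * n; l < 2 * n\<rbrakk> \<Longrightarrow>
    (\<Sum>x<n. cheb (2 * n) (2 * (n - 1 - x)) k l * c x)
      + (- 1) ^ k * (\<Sum>x<n. cheb (2 * n) (2 * (n - 1 - x)) k l * d x) = 0"
    and "x < n"
  shows "c x = 0 \<and> d x = 0"
proof -
  define F where "F c k l = (\<Sum>x<n. cheb (2 * n) (2 * (n - 1 - x)) k l * c x)" for c k l
  have row0: "F c 0 (2 * (n - 1 - x)) = c x" if "x < n" for c x
  proof -
    have "F c 0 (2 * (n - 1 - x)) = (\<Sum>y<n. if y = x then c y else 0)"
      unfolding F_def using that by (intro sum.cong) (auto simp: cheb_row_0)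
    then show ?thesis using that by simp
  qed
  \<comment> \<open>Row \<open>0\<close> of \<open>F c\<close> displays the coefficients, and the
    sign there is \<open>+1\<close>.\<close>
  have neg: "d x = - c x" if "x < n" for x
    using zero[of 0 "2 * (n - 1 - x)", folded F_def] that row0[OF that, of c] row0[OF that, of d]
    by simp
  have comm: "mmult (2 * n) path_mat (F c) i j = mmult (2 * n) (F c) path_mat i j"
    if "i < 2 * n" "j < 2 * n" for i j
    using that by (simp add: F_def[abs_def] mmult_sum cheb_commute)
  have "F d = (\<lambda>i j. - F c i j)"
    by (intro ext) (simp add: F_def neg sum_negf)
  \<comment> \<open>In row \<open>1\<close> the sign is \<open>-1\<close>, so the two sums add up
    instead of cancelling.\<close>
  then have row1: "F c 1 l = 0" if "l < 2 * n" for l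
    using zero[of 1 l, folded F_def] that by (cases n) simp_all
  have "c x = 0" if "x < n" for x
    using that
  proof (induction x)
    case 0
    \<comment> \<open>The last column has only a left neighbour, which isolates
      \<open>c 0\<close>.\<close>
    have "F c 0 (2 * (n - 1)) = mmult (2 * n) (F c) path_mat 0 (2 * n - 1)"
      using 0 by (cases n) (simp_all add: mmult_path)
    also have "\<dots> = F c 1 (2 * n - 1)"
      using 0 comm[of 0 "2 * n - 1"] by (simp add: path_mmult)
    also have "\<dots> = 0" using 0 by (intro row1) simp
    finally show ?case using 0 row0[of 0] by simp
  next
    case (Suc x)
    define k where "k = 2 * (n - 1 - Suc x)"
    have k: "k + 2 < 2 * n" "k + 2 = 2 * (n - 1 - x)" using Suc.prems by (auto simp: k_def)
    \<comment> \<open>Column \<open>k + 1\<close> lies between the places of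
      \<open>c (Suc x)\<close> and \<open>c x\<close> in row \<open>0\<close>.\<close>
    have "F c 0 k + F c 0 (k + 2) = mmult (2 * n) (F c) path_mat 0 (k + 1)"
      using k(1) by (simp add: mmult_path)
    also have "\<dots> = F c 1 (k + 1)"
      using k(1) comm[of 0 "k + 1"] by (simp add: path_mmult)
    also have "\<dots> = 0" using k(1) by (intro row1) simp
    finally have "c (Suc x) + c x = 0"
      unfolding k(2) unfolding k_def using row0 Suc.prems by simp
    then show ?case using Suc by simp
  qed
  then show ?thesis using neg assms by simp
qed

theorem theorem3p1:
  fixes n :: nat
  assumes "n \<ge> 1"
  shows "MD n \<sim>\<^sub>G HMD (n - 1) \<union>\<^sub>G HMD (n - 1) \<union>\<^sub>G R_graph n \<union>\<^sub>G R'_graph n"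
proof -
  define N where "N = 2 * n"
  let ?V = "verts (HMD (n - 1))"
  let ?B = "path_mat2 N"
  define C where "C x = cheb N (2 * (n - 1 - x))" for x
  define T1 where "T1 = (\<lambda>(k, l) w. skew_unit w k l)"
  define T2 where "T2 = (\<lambda>(k, l) w. comm N ?B (skew_unit w) k l)"
  define T3 where "T3 = (\<lambda>(k, l) w. C w k l)"
  define T4 where "T4 = (\<lambda>(k, l) w. (- 1) ^ k * ((- 1) ^ w * C w k l))"
  define T where "T u = case_sum (T1 u) (case_sum (T2 u) (case_sum (T3 u) (T4 u)))" for u
  show ?thesis
  proof (rule similar_graph_if_intertwines[where T = T])
    show "card (verts (MD n)) =
        card (verts (HMD (n - 1) \<union>\<^sub>G HMD (n - 1) \<union>\<^sub>G R_graph n \<union>\<^sub>G R'_graph n))"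
      by (simp add: card_black_squares card_Plus)
    show "intertwines (MD n) (HMD (n - 1) \<union>\<^sub>G HMD (n - 1) \<union>\<^sub>G R_graph n \<union>\<^sub>G R'_graph n) T"
      unfolding T_def[abs_def] T1_def T2_def T3_def T4_def C_def N_def
      by (intro intertwines_disjoint_union intertwines_MD)
        (simp_all only: path_skew_unit_path path_comm_skew_unit_path path_cheb_path_R_graph
          path_cheb_path_R'_graph verts_R_graph lessThan_iff finite_lessThan finite_verts_HMD
          verts_disjoint_union finite_Plus)
  next
    fix c
    assume c: "(\<Sum>w\<in>verts (HMD (n - 1) \<union>\<^sub>G HMD (n - 1) \<union>\<^sub>G R_graph n \<union>\<^sub>G R'_graph n).
        T u w * c w) = 0" if "u \<in> verts (MD n)" for u
    \<comment> \<open>Closed form of the combination of skew units, antisymmetric at all indices and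
      not only below \<open>N\<close>, as the lemmas on commutators require.\<close>
    define M where "M c k l =
      (if odd (k + l) \<or> k = l then 0 else if k < l then c (k, l - 2) else - c (l, k - 2))"
      for c :: "square \<Rightarrow> real" and k l
    \<comment> \<open>The sign in \<open>c4\<close> absorbs the factor \<open>(- 1) ^ w\<close> of
      \<open>T4\<close>.\<close>
    define c1 c2 c3 c4 where "c1 x = c (Inl x)" and "c2 x = c (Inr (Inl x))"
      and "c3 y = c (Inr (Inr (Inl y)))" and "c4 y = (- 1) ^ y * c (Inr (Inr (Inr y)))" for x y
    define F where "F a k l = (\<Sum>x<n. C x k l * a x)" for a k l
    have M: "M a k l = (\<Sum>x\<in>?V. skew_unit x k l * a x)" if "k < N" "l < N" for a k l
      using that unfolding M_def N_def by (simp only: sum_skew_unit)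
    have anti: "M a k l = - M a l k" for a k l
      by (auto simp: M_def)
    have white: "M a k l = 0" if "odd (k + l)" for a k l
      using that by (simp add: M_def)
    have whiteF: "F a k l = 0" if "odd (k + l)" for a k l
      using that by (simp add: F_def C_def cheb_parity)
    have symF: "F a k l = F a l k" if "k < N" "l < N" for a k l
      using that cheb_sym unfolding F_def C_def by (intro sum.cong) auto
    have commF: "comm N ?B (F a) k l = 0" if "k < N" "l < N" for a k l
      using that by (simp add: F_def[abs_def] C_def comm_sum comm_path_mat2_cheb)
    have symcomm: "comm N ?B (M a) k l = comm N ?B (M a) l k" for a k l
      by (rule comm_antisym_sym[OF path_mat2_sym anti])
    have whitecomm: "comm N ?B (M a) k l = 0" if "odd (k + l)" for a k l
      using that by (intro comm_parity path_mat2_parity white)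
    \<comment> \<open>The kernel condition speaks of black squares; on white ones all four terms
      vanish by parity.\<close>
    have total: "M c1 k l + comm N ?B (M c2) k l + F c3 k l + (- 1) ^ k * F c4 k l = 0"
      if kl: "k < N" "l < N" for k l
    proof (cases "even (k + l)")
      case True
      then have "(k, l) \<in> verts (MD n)" using kl by (simp add: black_squares_def N_def)
      from c[OF this] have "(\<Sum>x\<in>?V. skew_unit x k l * c1 x) + ((\<Sum>x\<in>?V. comm N ?B (skew_unit x) k l * c2 x)
          + ((\<Sum>x<n. C x k l * c3 x) + (\<Sum>x<n. (- 1) ^ k * ((- 1) ^ x * C x k l) * c (Inr (Inr (Inr x)))))) = 0"
        by (simp add: sum.Plus T_def T1_def T2_def T3_def T4_def c1_def c2_def c3_def)
      moreover have "(\<Sum>x\<in>?V. comm N ?B (skew_unit x) k l * c2 x) = comm N ?B (M c2) k l"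
        unfolding comm_sum[symmetric] by (rule comm_cong) (simp_all add: M kl)
      moreover have "(\<Sum>x<n. (- 1) ^ k * ((- 1) ^ x * C x k l) * c (Inr (Inr (Inr x)))) = (- 1) ^ k * F c4 k l"
        by (simp add: F_def c4_def sum_distrib_left mult_ac)
      ultimately show ?thesis by (simp add: M[OF kl] F_def)
    next
      case False
      then show ?thesis by (simp add: white whiteF whitecomm)
    qed
    \<comment> \<open>On black squares the other three terms are symmetric, so comparing
      \<open>total\<close> with its transpose isolates \<open>M c1\<close>.\<close>
    have M1: "M c1 k l = 0" if kl: "k < N" "l < N" for k l
    proof (cases "even (k + l)")
      case True
      then have "(- 1 :: real) ^ k = (- 1) ^ l" by (auto simp: minus_one_power_iff)
      then show ?thesis
        using total[OF kl] total[OF kl(2,1)] symcomm[of c2 k l] symF[OF kl] anti[of c1 k l] by simp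
    qed (simp add: white)
    have comm2: "comm N ?B (M c2) k l = - (F c3 k l + (- 1) ^ k * F c4 k l)" if "k < N" "l < N" for k l
      using total[OF that] M1[OF that] by simp
    \<comment> \<open>The alternating sign anticommutes with \<open>A\<close>, hence commutes with
      \<open>A\<^sup>2\<close>, as do the polynomials \<open>F c3\<close> and
      \<open>F c4\<close>.\<close>
    have comm3: "comm N ?B (\<lambda>k l. - (F c3 k l + (- 1) ^ k * F c4 k l)) k l = 0"
      if kl: "k < N" "l < N" for k l
    proof -
      have "mmult N ?B (\<lambda>i j. (- 1) ^ i * F c4 i j) k l = (- 1) ^ k * mmult N ?B (F c4) k l"
      proof -
        have "mmult N ?B (\<lambda>i j. (- 1) ^ i * F c4 i j) k l
          = mmult N path_mat (\<lambda>i j. (- 1) ^ i * - mmult N path_mat (F c4) i j) k l"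
          unfolding mmult_assoc by (rule mmult_cong) (simp_all add: path_mmult_alternating)
        also have "\<dots> = (- 1) ^ k * mmult N ?B (F c4) k l"
          unfolding path_mmult_alternating mmult_assoc by (simp add: mmult_def[of N path_mat] sum_negf)
        finally show ?thesis .
      qed
      then have "comm N ?B (\<lambda>k l. (- 1) ^ k * F c4 k l) k l = (- 1) ^ k * comm N ?B (F c4) k l"
        by (simp add: comm_def mmult_alternating right_diff_distrib)
      moreover have "comm N ?B (\<lambda>k l. - (f k l + g k l)) k l = - (comm N ?B f k l + comm N ?B g k l)" for f g
        by (simp add: comm_def mmult_def[of N ?B] mmult_def[of N _ ?B] distrib_left distrib_right
            sum.distrib sum_negf del: minus_add_distrib)
      ultimately show ?thesis using commF[OF kl] by simp
    qed
    have comm2_twice: "comm N ?B (comm N ?B (M c2)) k l = 0" if "k < N" "l < N" for k l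
      using comm_cong[of N "comm N ?B (M c2)", OF comm2 that] comm3[OF that] by simp
    have comm0: "comm N ?B (M c2) k l = 0" if "k < N" "l < N" for k l
      by (rule comm_comm_eq_0[OF path_mat2_sym comm2_twice that])
    have M2: "M c2 k l = 0" if "k < N" "l < N" for k l
    proof (rule commutes_path_mat2_antisym_eq_0[where N = N])
      show "M c2 i j = - M c2 j i" for i j by (rule anti)
    qed (use that white comm0 in auto)
    have F0: "F c3 k l + (- 1) ^ k * F c4 k l = 0" if "k < N" "l < N" for k l
      using comm0[OF that] comm2[OF that] by simp
    have c34: "c3 x = 0 \<and> c4 x = 0" if "x < n" for x
      by (rule cheb_sum_eq_0[OF F0[unfolded F_def C_def N_def] that])
    \<comment> \<open>The coefficient at \<open>(i, j)\<close> is the entry of \<open>M a\<close> at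
      the shifted square \<open>(i, j + 2)\<close>.\<close>
    have Mc: "a (i, j) = 0" if "(i, j) \<in> ?V" "\<And>k l. \<lbrakk>k < N; l < N\<rbrakk> \<Longrightarrow> M a k l = 0" for a i j
      using that(1) that(2)[of i "j + 2"] by (auto simp: M_def verts_HMD N_def)
    show "\<forall>w\<in>verts (HMD (n - 1) \<union>\<^sub>G HMD (n - 1) \<union>\<^sub>G R_graph n \<union>\<^sub>G R'_graph n). c w = 0"
      using Mc[of _ _ c1, OF _ M1] Mc[of _ _ c2, OF _ M2] c34
      by (auto simp: c1_def c2_def c3_def c4_def)
  qed simp_all
qed

end
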